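(* Let $T$ be a weakly almost periodic operator on a (real or complex) Banach space $X$. Let $\phi:\mathbb R^+\to\mathbb R^+$ be a strictly increasing function with $\lim_{x\to\infty}\phi(x)=\infty$, and let $(a_k)_{k\ge 1}$ be a sequence of complex numbers (real numbers if $X$ is a real Banach space) such that $$\sup_{n\ge1}\frac1n\sum_{k=1}^n|a_k|\,\phi(|a_k|)<\infty.$$ Then for every flight vector $x\in X$ of $T$ we have $$\lim_{n\to\infty}\Big\|\frac1n\sum_{k=1}^n a_kT^kx\Big\|=0.$$
   Context: A bounded linear operator $T$ on a Banach space $X$ is called weakly almost periodic if for every $x\in X$ the orbit $\{T^nx\}_{n\ge0}$ is weakly conditionally compact (i.e. relatively weakly compact). If $T$ is weakly almost periodic, a vector $x\in X$ is called a flight vector for $T$ if $0$ is in the weak closure of its orbit $\{T^nx\}_{n\ge0}$ (equivalently, $T^{n_j}x\to0$ weakly for some subsequence $(n_j)$). Here $\mathbb R^+=[0,\infty)$. *)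

theory Defs
  imports "HOL-Analysis.Analysis"
begin

text \<open>A complex normed space is a real normed space (in the sense of the library's type class)
  with a compatible complex scalar multiplication; it is a complex Banach space when the carrier
  type is of class \<open>banach\<close>. Real spaces use \<open>scaleR\<close> as their scalar multiplication.\<close>

locale complex_normed_space = vector_space smul
  for smul :: "complex \<Rightarrow> 'a::real_normed_vector \<Rightarrow> 'a" +
  assumes smul_of_real: "smul (of_real r) x = r *\<^sub>R x"
    and norm_smul: "norm (smul c x) = norm c * norm x"

text \<open>The notions below take the scalar multiplication as an argument, the scalar field
  being \<^typ>\<open>real\<close> or \<^typ>\<open>complex\<close>. For \<open>s1 = s2 = scaleR\<close>, homogeneity is already part
  of \<open>bounded_linear\<close>.\<close>

definition bounded_linear_over ::
    "('k \<Rightarrow> 'a::real_normed_vector \<Rightarrow> 'a) \<Rightarrow> ('k \<Rightarrow> 'b::real_normed_vector \<Rightarrow> 'b) \<Rightarrow> ('a \<Rightarrow> 'b) \<Rightarrow> bool" where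
  "bounded_linear_over s1 s2 f \<longleftrightarrow> bounded_linear f \<and> (\<forall>c x. f (s1 c x) = s2 c (f x))"

definition weak_topology ::
    "('k::real_normed_field \<Rightarrow> 'a::real_normed_vector \<Rightarrow> 'a) \<Rightarrow> 'a topology" where
  "weak_topology smul =
     topology_generated_by {f -` U | (f :: 'a \<Rightarrow> 'k) U. bounded_linear_over smul (*) f \<and> open U}"

definition orbit :: "('a \<Rightarrow> 'a) \<Rightarrow> 'a \<Rightarrow> 'a set" where
  "orbit T x = range (\<lambda>n. (T ^^ n) x)"

definition weakly_almost_periodic ::
    "('k::real_normed_field \<Rightarrow> 'a::real_normed_vector \<Rightarrow> 'a) \<Rightarrow> ('a \<Rightarrow> 'a) \<Rightarrow> bool" where
  "weakly_almost_periodic smul T \<longleftrightarrow>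
     bounded_linear_over smul smul T \<and>
     (\<forall>x. compactin (weak_topology smul) (weak_topology smul closure_of orbit T x))"

definition flight_vector ::
    "('k::real_normed_field \<Rightarrow> 'a::real_normed_vector \<Rightarrow> 'a) \<Rightarrow> ('a \<Rightarrow> 'a) \<Rightarrow> 'a \<Rightarrow> bool" where
  "flight_vector smul T x \<longleftrightarrow> 0 \<in> weak_topology smul closure_of orbit T x"

end

theory Submission imports Defs
begin

text \<open>A flight vector \<open>x\<close> satisfies \<open>sup {(1/n) \<Sum>k\<le>n. \<bar>f (T^k x)\<bar> | \<parallel>f\<parallel> \<le> 1} \<rightarrow> 0\<close>; the weights \<open>a\<^sub>k\<close> are
  then handled by truncation at a level \<open>L\<close>, the growth condition giving
  \<open>(1/n) \<Sum>\<bar>a\<^sub>k\<bar> = O(1/\<phi> L)\<close> for the sum over \<open>\<bar>a\<^sub>k\<bar> > L\<close>, and complex weights split into real and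
  imaginary parts. For the uniform statement, choose \<open>n\<^sub>j\<close> with \<open>T^(n\<^sub>j) x \<rightarrow> 0\<close> weakly. If it fails,
  there are \<open>f\<^sub>N\<close> in the dual ball, for infinitely many \<open>N\<close>, such that \<open>\<bar>f\<^sub>N (T^k x)\<bar> \<ge> e/2\<close> for a positive
  proportion of the \<open>k \<le> N\<close>, hence, for each \<open>j\<close>,
  such that \<open>\<bar>f\<^sub>N (T^(k + n\<^sub>j) x)\<bar> \<ge> e/2\<close> for a positive proportion as well. As in Bergelson's
  intersectivity lemma, some \<open>f\<^sub>N \<circ> T^k\<close> satisfies this for many \<open>j\<close> at once, and a weak-star cluster point
  \<open>g\<close> of these functionals has \<open>\<bar>g (T^(n\<^sub>j) x)\<bar> \<ge> e/2\<close> for infinitely many \<open>j\<close>, contradicting weak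
  convergence.\<close>

section \<open>Hahn--Banach and uniform boundedness\<close>

text \<open>Homogeneity is stated as one inequality, the form that infima satisfy directly. Applying
  it to \<open>1 / c\<close> yields the equality, and \<open>c = 2\<close> at 0 then yields
  \<open>p 0 = 0\<close>.\<close>

definition sublinear :: "('a::real_vector \<Rightarrow> real) \<Rightarrow> bool" where
  "sublinear p \<longleftrightarrow> (\<forall>x y. p (x + y) \<le> p x + p y) \<and> (\<forall>c>0. \<forall>x. p (c *\<^sub>R x) \<le> c * p x)"

lemma sublinearI:
  assumes "\<And>x y. p (x + y) \<le> p x + p y" "\<And>c x. c > 0 \<Longrightarrow> p (c *\<^sub>R x) \<le> c * p x"
  shows "sublinear p"
  using assms by (auto simp: sublinear_def)

lemma sublinear_add: "sublinear p \<Longrightarrow> p (x + y) \<le> p x + p y"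
  by (simp add: sublinear_def)

lemma sublinear_scaleR:
  assumes "sublinear p" "c > 0"
  shows "p (c *\<^sub>R x) = c * p x"
proof (rule antisym)
  show "p (c *\<^sub>R x) \<le> c * p x" using assms by (simp add: sublinear_def)
  have "p ((1 / c) *\<^sub>R (c *\<^sub>R x)) \<le> (1 / c) * p (c *\<^sub>R x)"
    using assms unfolding sublinear_def by (meson zero_less_divide_1_iff)
  then show "c * p x \<le> p (c *\<^sub>R x)" using assms(2) by (simp add: field_simps)
qed

lemma sublinear_zero:
  assumes "sublinear p" shows "p 0 = 0"
  using sublinear_scaleR[OF assms, of 2 0] by simp

lemma sublinear_minus:
  assumes "sublinear p" shows "- p (- x) \<le> p x"
  using sublinear_add[OF assms, of x "- x"] sublinear_zero[OF assms] by simp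

text \<open>The witness is the infimum of \<open>q (x + t *\<^sub>R y) - t * q y\<close> over
  \<open>t \<ge> 0\<close>, bounded below by \<open>- q (- x)\<close>. The value
  \<open>t = 0\<close> keeps it below \<open>q\<close>, and \<open>t = 1\<close> gives the bound at
  \<open>- y\<close>. It serves both to prescribe a value at one point and to show that minimal
  functionals are odd.\<close>

lemma sublinear_reduce:
  fixes q :: "'a::real_vector \<Rightarrow> real"
  assumes q: "sublinear q"
  obtains q' where "sublinear q'" "\<And>x. q' x \<le> q x" "q' (- y) \<le> - q y"
proof
  define h where "h x t = q (x + t *\<^sub>R y) - t * q y" for x t
  define q' where "q' x = (INF t\<in>{0..}. h x t)" for x
  have hom: "q (t *\<^sub>R y) = t * q y" if "t \<ge> 0" for t
    using that sublinear_scaleR[OF q, of t y] sublinear_zero[OF q] by (cases "t = 0") auto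
  have lb: "- q (- x) \<le> h x t" if "t \<ge> 0" for x t
    using sublinear_add[OF q, of "x + t *\<^sub>R y" "- x"] hom[OF that] by (simp add: h_def)
  have bdd: "bdd_below (h x ` {0..})" for x
    by (rule bdd_belowI2[of _ "- q (- x)"]) (use lb in auto)
  have le: "q' x \<le> h x t" if "t \<ge> 0" for x t
    unfolding q'_def by (rule cINF_lower[OF bdd]) (use that in auto)
  have ge: "c \<le> q' x" if "\<And>t. t \<ge> 0 \<Longrightarrow> c \<le> h x t" for c x
    unfolding q'_def by (rule cINF_greatest) (use that in auto)
  show "sublinear q'"
  proof (rule sublinearI)
    fix x z
    have "q' (x + z) - h x s \<le> h z t" if "s \<ge> 0" "t \<ge> 0" for s t
      using le[of "s + t" "x + z"] that sublinear_add[OF q, of "x + s *\<^sub>R y" "z + t *\<^sub>R y"]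
      by (simp add: h_def algebra_simps)
    then have "q' (x + z) - h x s \<le> q' z" if "s \<ge> 0" for s
      using that by (intro ge) auto
    then have "q' (x + z) - q' z \<le> q' x"
      by (intro ge) (simp add: algebra_simps)
    then show "q' (x + z) \<le> q' x + q' z" by simp
  next
    fix c :: real and x assume c: "c > 0"
    have "q' (c *\<^sub>R x) / c \<le> q' x"
    proof (rule ge)
      fix t :: real assume t: "t \<ge> 0"
      have "q' (c *\<^sub>R x) \<le> h (c *\<^sub>R x) (c * t)" using c t by (intro le) auto
      also have "\<dots> = q (c *\<^sub>R (x + t *\<^sub>R y)) - c * (t * q y)"
        by (simp add: h_def algebra_simps)
      also have "\<dots> = c * h x t"
        unfolding sublinear_scaleR[OF q c] by (simp add: h_def algebra_simps)
      finally show "q' (c *\<^sub>R x) / c \<le> h x t" using c by (simp add: field_simps)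
    qed
    then show "q' (c *\<^sub>R x) \<le> c * q' x" using c by (simp add: field_simps)
  qed
  show "q' x \<le> q x" for x using le[of 0 x] by (simp add: h_def)
  show "q' (- y) \<le> - q y" using le[of 1 "- y"] sublinear_zero[OF q] by (simp add: h_def)
qed

text \<open>A minimal sublinear functional is linear, since \<open>sublinear_reduce\<close> cannot decrease it.\<close>

lemma sublinear_minimal:
  fixes p :: "'a::real_vector \<Rightarrow> real"
  assumes p: "sublinear p"
  obtains m where "sublinear m" "\<And>x. m x \<le> p x"
    "\<And>q. sublinear q \<Longrightarrow> (\<And>x. q x \<le> m x) \<Longrightarrow> q = m"
proof -
  let ?A = "{q. sublinear q \<and> (\<forall>x. q x \<le> p x)}"
  \<comment> \<open>The order is reversed, so that a maximal element in Zorn's lemma is a pointwise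
    minimal functional.\<close>
  let ?P = "\<lambda>q q' :: 'a \<Rightarrow> real. \<forall>x. q' x \<le> q x"
  have "\<exists>m\<in>?A. \<forall>q\<in>?A. ?P m q \<longrightarrow> q = m"
  proof (rule predicate_Zorn)
    show "partial_order_on ?A (relation_of ?P ?A)"
    proof (rule partial_order_on_relation_ofI)
      fix q r s :: "'a \<Rightarrow> real"
      show "?P q q" by simp
      show "?P q s" if "?P q r" "?P r s" using that by (meson order_trans)
      show "q = r" if "?P q r" "?P r q" using that by (auto intro!: ext antisym)
    qed
  next
    fix C assume "C \<in> Chains (relation_of ?P ?A)"
    then have CA: "C \<subseteq> ?A" and chain: "\<And>q r. q \<in> C \<Longrightarrow> r \<in> C \<Longrightarrow> ?P q r \<or> ?P r q"
      by (auto simp: Chains_def relation_of_def)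
    show "\<exists>u\<in>?A. \<forall>a\<in>C. ?P a u"
    proof (cases "C = {}")
      case True then show ?thesis using p by auto
    next
      case False
      define u where "u x = (INF q\<in>C. q x)" for x
      \<comment> \<open>This lower bound does not depend on \<open>q\<close>, so the infimum over
        the chain is finite.\<close>
      have "- p (- x) \<le> q x" if "q \<in> C" for q x
      proof -
        have "q (- x) \<le> p (- x)" "- q (- x) \<le> q x"
          using CA that by (auto intro: sublinear_minus)
        then show ?thesis by simp
      qed
      then have bdd: "bdd_below ((\<lambda>q. q x) ` C)" for x
        by (intro bdd_belowI2[of _ "- p (- x)"]) auto
      have le: "u x \<le> q x" if "q \<in> C" for q x
        unfolding u_def by (rule cINF_lower[OF bdd that])
      have ge: "c \<le> u x" if "\<And>q. q \<in> C \<Longrightarrow> c \<le> q x" for c x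
        unfolding u_def by (rule cINF_greatest) (use that False in auto)
      have "sublinear u"
      proof (rule sublinearI)
        fix x y
        \<comment> \<open>Two different members of the chain are replaced by the smaller one, whose
          subadditivity applies.\<close>
        have split: "u (x + y) \<le> q x + r y" if qr: "q \<in> C" "r \<in> C" for q r
        proof -
          obtain s where s: "s \<in> C" "?P q s" "?P r s"
            using chain[OF qr] qr by auto
          have "u (x + y) \<le> s x + s y"
            using le[OF s(1), of "x + y"] sublinear_add[of s x y] s(1) CA by force
          also have "\<dots> \<le> q x + r y" using s by (intro add_mono) auto
          finally show ?thesis .
        qed
        have "u (x + y) - q x \<le> u y" if "q \<in> C" for q
          by (rule ge) (use split[OF that] in \<open>simp add: diff_le_eq add.commute\<close>)
        then have "u (x + y) - u y \<le> u x"
          by (intro ge) (simp add: algebra_simps)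
        then show "u (x + y) \<le> u x + u y" by simp
      next
        fix c :: real and x assume c: "c > 0"
        have "u (c *\<^sub>R x) / c \<le> u x"
        proof (rule ge)
          fix q assume q: "q \<in> C"
          then have "u (c *\<^sub>R x) \<le> c * q x"
            using le[OF q, of "c *\<^sub>R x"] sublinear_scaleR[of q c x] c CA by auto
          then show "u (c *\<^sub>R x) / c \<le> q x" using c by (simp add: field_simps)
        qed
        then show "u (c *\<^sub>R x) \<le> c * u x" using c by (simp add: field_simps)
      qed
      moreover have "u x \<le> p x" for x
      proof -
        obtain q where "q \<in> C" using False by blast
        then have "u x \<le> q x" "q x \<le> p x" using CA le by auto
        then show ?thesis by simp
      qed
      ultimately show ?thesis using le by auto
    qed
  qed
  then obtain m where "m \<in> ?A" "\<And>q. q \<in> ?A \<Longrightarrow> ?P m q \<Longrightarrow> q = m" by blast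
  then show ?thesis
    by (intro that[of m]) (auto intro: order_trans)
qed

text \<open>First \<open>p\<close> is lowered to \<open>p'\<close> with
  \<open>p' (- x0) \<le> - p x0\<close>. A minimal \<open>m\<close> below \<open>p'\<close> is odd,
  and oddness turns subadditivity into additivity and the bound at \<open>- x0\<close> into
  \<open>p x0 \<le> m x0\<close>.\<close>

theorem Hahn_Banach_sublinear:
  fixes p :: "'a::real_vector \<Rightarrow> real"
  assumes p: "sublinear p"
  obtains f where "linear f" "\<And>x. f x \<le> p x" "f x0 = p x0"
proof -
  obtain p' where p': "sublinear p'" "\<And>x. p' x \<le> p x" "p' (- x0) \<le> - p x0"
    using sublinear_reduce[OF p] by metis
  obtain m where m: "sublinear m" "\<And>x. m x \<le> p' x"
    and min: "\<And>q. sublinear q \<Longrightarrow> (\<And>x. q x \<le> m x) \<Longrightarrow> q = m"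
    using sublinear_minimal[OF p'(1)] by metis
  have neg: "m (- y) = - m y" for y
  proof (rule antisym)
    obtain q where "sublinear q" "\<And>x. q x \<le> m x" "q (- y) \<le> - m y"
      using sublinear_reduce[OF m(1)] by metis
    then show "m (- y) \<le> - m y" using min by blast
    show "- m y \<le> m (- y)" using sublinear_minus[OF m(1), of "- y"] by simp
  qed
  have "linear m"
  proof (rule linearI)
    fix x y
    have "m (- x + - y) \<le> m (- x) + m (- y)" by (rule sublinear_add[OF m(1)])
    then have "m x + m y \<le> m (x + y)" using neg[of "x + y"] by (simp add: neg)
    then show "m (x + y) = m x + m y" using sublinear_add[OF m(1), of x y] by simp
  next
    fix c :: real and x
    consider "c = 0" | "c > 0" | "- c > 0" by linarith
    then show "m (c *\<^sub>R x) = c *\<^sub>R m x"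
    proof cases
      case 3
      then show ?thesis using sublinear_scaleR[OF m(1), of "- c" x] neg[of "c *\<^sub>R x"] by simp
    qed (use sublinear_zero[OF m(1)] sublinear_scaleR[OF m(1), of c x] in auto)
  qed
  moreover have "m x \<le> p x" for x using m(2) p'(2) order_trans by blast
  moreover have "m x0 = p x0"
    using m(2)[of "- x0"] p'(3) neg[of x0] \<open>m x0 \<le> p x0\<close> by simp
  ultimately show ?thesis using that by blast
qed

text \<open>Functionals are kept as plain functions, so that the topology of pointwise convergence
  on the function type is the weak-star topology on the ball. The radius is a parameter because
  composition with powers of \<open>T\<close> enlarges the unit ball.\<close>

definition dual_cball :: "real \<Rightarrow> ('a::real_normed_vector \<Rightarrow> real) set" where
  "dual_cball M = {f. linear f \<and> (\<forall>x. \<bar>f x\<bar> \<le> M * norm x)}"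

lemma dual_cball_bounded_linear: "f \<in> dual_cball M \<Longrightarrow> bounded_linear f"
  by (auto simp: dual_cball_def linear_conv_bounded_linear[symmetric] mult.commute
      intro!: bounded_linear_intro[where K=M] linear_add linear_cmul)

lemma dual_cball_of_le_norm:
  assumes "linear f" "\<And>x. f x \<le> norm x"
  shows "f \<in> dual_cball 1"
proof -
  have "- f x \<le> norm x" for x using assms(2)[of "- x"] linear_neg[OF assms(1), of x] by simp
  then show ?thesis using assms by (auto simp: dual_cball_def abs_le_iff)
qed

section \<open>Norming and separating functionals\<close>

lemma norming_functional:
  fixes x :: "'a::real_normed_vector"
  obtains f where "f \<in> dual_cball 1" "f x = norm x"
proof -
  have "sublinear (norm :: 'a \<Rightarrow> real)"
    by (rule sublinearI) (auto intro: norm_triangle_ineq)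
  then show ?thesis
    using that Hahn_Banach_sublinear[of norm x] dual_cball_of_le_norm by metis
qed

lemma sublinear_infdist_subspace:
  fixes S :: "'a::real_normed_vector set"
  assumes S: "subspace S"
  shows "sublinear (\<lambda>x. infdist x S)"
proof (rule sublinearI)
  have ne: "S \<noteq> {}" using S subspace_0 by auto
  have ge: "b \<le> infdist x S" if "\<And>s. s \<in> S \<Longrightarrow> b \<le> dist x s" for b x
    using that ne by (auto simp: infdist_def intro!: cINF_greatest)
  fix x y
  have "infdist (x + y) S - dist x s \<le> dist y t" if "s \<in> S" "t \<in> S" for s t
  proof -
    have "infdist (x + y) S \<le> dist (x + y) (s + t)"
      using that S by (intro infdist_le subspace_add)
    also have "\<dots> \<le> dist x s + dist y t" by (rule dist_triangle_add)
    finally show ?thesis by simp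
  qed
  then have "infdist (x + y) S - dist x s \<le> infdist y S" if "s \<in> S" for s
    using that by (intro ge) auto
  then have "infdist (x + y) S - infdist y S \<le> infdist x S"
    by (intro ge) (simp add: algebra_simps)
  then show "infdist (x + y) S \<le> infdist x S + infdist y S" by simp
  fix c :: real assume c: "c > 0"
  have "infdist (c *\<^sub>R x) S / c \<le> infdist x S"
  proof (rule ge)
    fix s assume "s \<in> S"
    then have "infdist (c *\<^sub>R x) S \<le> dist (c *\<^sub>R x) (c *\<^sub>R s)"
      using S by (intro infdist_le subspace_scale)
    also have "\<dots> = c * dist x s" using c by (simp add: dist_norm flip: scaleR_diff_right)
    finally show "infdist (c *\<^sub>R x) S / c \<le> dist x s" using c by (simp add: field_simps)
  qed
  then show "infdist (c *\<^sub>R x) S \<le> c * infdist x S" using c by (simp add: field_simps)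
qed

text \<open>The distance to \<open>S\<close> is sublinear. A linear functional below it is at most 0
  at \<open>s\<close> and at \<open>- s\<close>, hence zero on \<open>S\<close>; at \<open>z\<close>
  it attains the distance, which is nonzero because \<open>S\<close> is closed.\<close>

lemma separating_functional:
  fixes S :: "'a::real_normed_vector set"
  assumes S: "subspace S" "closed S" and z: "z \<notin> S"
  obtains f :: "'a \<Rightarrow> real" where "bounded_linear f" "\<And>s. s \<in> S \<Longrightarrow> f s = 0" "f z \<noteq> 0"
proof -
  have ne: "S \<noteq> {}" using S subspace_0 by auto
  obtain f where f: "linear f" "\<And>x. f x \<le> infdist x S" "f z = infdist z S"
    using Hahn_Banach_sublinear[OF sublinear_infdist_subspace[OF S(1)], of z] by metis
  have "infdist x S \<le> norm x" for x
    using infdist_le[OF subspace_0[OF S(1)], of x] by simp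
  then have "f \<in> dual_cball 1"
    using f by (intro dual_cball_of_le_norm) (auto intro: order_trans)
  then have "bounded_linear f" by (rule dual_cball_bounded_linear)
  moreover have "f s = 0" if "s \<in> S" for s
    using f(2)[of s] f(2)[of "- s"] that subspace_neg[OF S(1) that] linear_neg[OF f(1), of s] by simp
  moreover have "f z \<noteq> 0"
    using f(3) z S(2) ne in_closed_iff_infdist_zero by metis
  ultimately show ?thesis using that[of f] by simp
qed

text \<open>By Baire's theorem one of the closed sets \<open>A m\<close> contains a ball, and a
  small multiple of any \<open>x\<close> is a difference of two points of that ball.\<close>

theorem uniform_boundedness:
  fixes f :: "'i \<Rightarrow> 'a::banach \<Rightarrow> 'b::real_normed_vector"
  assumes bl: "\<And>i. bounded_linear (f i)"
    and bdd: "\<And>x. \<exists>B. \<forall>i. norm (f i x) \<le> B"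
  obtains M where "\<And>i x. norm (f i x) \<le> M * norm x"
proof -
  define A where "A m = {x. \<forall>i. norm (f i x) \<le> real m}" for m
  have clA: "closed (A m)" for m
    unfolding A_def Collect_all_eq
    by (intro closed_INT ballI closed_Collect_le continuous_intros bounded_linear.continuous_on[OF bl])
  have "\<exists>m. interior (A m) \<noteq> {}"
  proof (rule ccontr)
    assume "\<not> ?thesis"
    then have "interior (\<Union>(range A)) = {}"
      using Met_TC.metric_Baire_category_alt[of "range A"] clA
      by (auto simp: interior_of_def interior_def complete_UNIV)
    moreover have "x \<in> \<Union>(range A)" for x
    proof -
      obtain B where "\<And>i. norm (f i x) \<le> B" using bdd by blast
      moreover obtain m where "B \<le> real m" using real_arch_simple by blast
      ultimately show ?thesis by (auto simp: A_def intro: order_trans)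
    qed
    ultimately show False by (metis UNIV_eq_I UNIV_not_empty interior_UNIV)
  qed
  then obtain m x0 e where e: "e > 0" "ball x0 e \<subseteq> A m"
    by (meson all_not_in_conv mem_interior)
  have "norm (f i x) \<le> (4 * real m / e) * norm x" for i x
  proof (cases "x = 0")
    case True then show ?thesis using bl by (simp add: bounded_linear.linear linear_0)
  next
    case False
    \<comment> \<open>The vector \<open>c *\<^sub>R x\<close> has norm \<open>e / 2\<close>, so
      translating the centre by it stays inside the ball.\<close>
    define c where "c = e / (2 * norm x)"
    have c: "c > 0" using e False by (simp add: c_def)
    have "x0 + c *\<^sub>R x \<in> ball x0 e" "x0 \<in> ball x0 e"
      using e False by (auto simp: dist_norm c_def)
    then have "x0 + c *\<^sub>R x \<in> A m" "x0 \<in> A m" by (auto intro!: subsetD[OF e(2)])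
    then have "norm (f i (x0 + c *\<^sub>R x)) \<le> m" "norm (f i x0) \<le> m"
      by (auto simp: A_def)
    moreover have "f i (x0 + c *\<^sub>R x) = f i x0 + c *\<^sub>R f i x"
      using bl by (simp add: bounded_linear.linear linear_add linear_cmul)
    ultimately have "norm (c *\<^sub>R f i x) \<le> 2 * real m"
      using norm_triangle_ineq4[of "f i x0 + c *\<^sub>R f i x" "f i x0"] by simp
    then show ?thesis using c e False by (simp add: c_def field_simps)
  qed
  then show ?thesis using that by blast
qed

text \<open>Each \<open>y i\<close> acts by evaluation on the dual, which is a Banach space, so
  uniform boundedness applies there; a norming functional brings the bound back to
  \<open>norm (y i)\<close>.\<close>

lemma weakly_bounded_imp_bounded:
  fixes y :: "'i \<Rightarrow> 'a::real_normed_vector"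
  assumes "\<And>f :: 'a \<Rightarrow> real. bounded_linear f \<Longrightarrow> \<exists>B. \<forall>i. \<bar>f (y i)\<bar> \<le> B"
  obtains B where "\<And>i. norm (y i) \<le> B"
proof -
  obtain M where M: "\<And>i (f :: 'a \<Rightarrow>\<^sub>L real). norm (blinfun_apply f (y i)) \<le> M * norm f"
    using uniform_boundedness[of "\<lambda>i (f :: 'a \<Rightarrow>\<^sub>L real). blinfun_apply f (y i)"]
      assms[OF blinfun.bounded_linear_right] blinfun.bounded_linear_left
    by (metis real_norm_def)
  have "norm (y i) \<le> \<bar>M\<bar>" for i
  proof -
    obtain f where f: "f \<in> dual_cball 1" "f (y i) = norm (y i)" by (rule norming_functional)
    define F where "F = Blinfun f"
    have F: "blinfun_apply F = f"
      unfolding F_def using f by (simp add: bounded_linear_Blinfun_apply dual_cball_bounded_linear)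
    have "norm F \<le> 1"
      using f by (intro norm_blinfun_bound) (auto simp: F dual_cball_def)
    have "norm (y i) \<le> M * norm F" using M[of F i] f F by simp
    also have "\<dots> \<le> \<bar>M\<bar> * 1" using \<open>norm F \<le> 1\<close> by (intro mult_mono) auto
    finally show ?thesis by simp
  qed
  then show ?thesis using that by blast
qed

section \<open>Intersections of sets of positive density\<close>

text \<open>The cube of functions into \<open>{-1..1}\<close> is compact by Tychonoff and, the index
  type being countable, sequentially compact; this replaces a diagonal argument.\<close>

lemma countable_convergent_subsequence:
  fixes u :: "nat \<Rightarrow> 'b::countable \<Rightarrow> real"
  assumes "\<And>i q. \<bar>u i q\<bar> \<le> 1"
  obtains r l where "strict_mono (r :: nat \<Rightarrow> nat)" "\<And>q. (\<lambda>i. u (r i) q) \<longlonglongrightarrow> l q"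
proof -
  have "compact (PiE UNIV (\<lambda>_::'b. {-1..1::real}))"
    using compactin_PiE[of "\<lambda>_. euclidean" UNIV "\<lambda>_::'b. {-1..1::real}"]
    by (simp add: euclidean_product_topology)
  then have "seq_compact (PiE UNIV (\<lambda>_::'b. {-1..1::real}))" by (rule compact_imp_seq_compact)
  moreover have "u i \<in> PiE UNIV (\<lambda>_::'b. {-1..1::real})" for i
    using assms by (auto simp: abs_le_iff minus_le_iff)
  ultimately obtain l r where r: "strict_mono r" "(u \<circ> r) \<longlonglongrightarrow> l"
    unfolding seq_compact_def by blast
  have "(\<lambda>i. u (r i) q) \<longlonglongrightarrow> l q" for q
    using continuous_on_tendsto_compose[OF continuous_on_product_coordinates[of q], of "u \<circ> r" l] r(2)
    by auto
  then show ?thesis using that r(1) by blast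
qed

text \<open>The windows \<open>{m..p m}\<close> are fixed before \<open>M\<close>; only
  \<open>i\<close> and \<open>k\<close> depend on \<open>M\<close>. This lets a compactness argument
  pass to all \<open>m\<close> at once. The window for \<open>m\<close> is taken so long that, in
  the limit along a subsequence, the union of the \<open>E i j\<close> over it nearly exhausts the
  density of all later unions.\<close>

lemma density_intersections:
  fixes E :: "nat \<Rightarrow> nat \<Rightarrow> nat set" and N :: "nat \<Rightarrow> nat"
  assumes sub: "\<And>i j. E i j \<subseteq> {1..N i}"
    and d: "d > 0"
    and dens: "\<And>j. eventually (\<lambda>i. d * real (N i) \<le> real (card (E i j))) sequentially"
    and pos: "\<And>i. N i > 0"
  obtains p :: "nat \<Rightarrow> nat"
    where "\<And>M. \<exists>i k. \<forall>m\<le>M. \<exists>j\<in>{m..p m}. k \<in> E i j"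
proof -
  define U where "U i m q = (\<Union>j\<in>{m..q}. E i j)" for i m q
  define u where "u i mq = real (card (U i (fst mq) (snd mq))) / real (N i)" for i mq
  have Usub: "U i m q \<subseteq> {1..N i}" for i m q using sub by (auto simp: U_def)
  have finU: "finite (U i m q)" for i m q by (rule finite_subset[OF Usub]) simp
  have "card (U i m q) \<le> N i" for i m q
    using card_mono[OF _ Usub[of i m q]] by simp
  then have u1: "\<bar>u i mq\<bar> \<le> 1" for i mq using pos by (simp add: u_def field_simps)
  obtain r l where r: "strict_mono (r :: nat \<Rightarrow> nat)"
    and l: "\<And>mq. (\<lambda>i. u (r i) mq) \<longlonglongrightarrow> l mq"
    using countable_convergent_subsequence[of u, OF u1] by metis
  have l1: "l mq \<le> 1" for mq
    using LIMSEQ_le_const2[OF l] u1 abs_le_D1 by blast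
  define s where "s m = (SUP q\<in>{m..}. l (m, q))" for m
  have bdd: "bdd_above ((\<lambda>q. l (m, q)) ` {m..})" for m
    by (rule bdd_aboveI2[of _ _ 1]) (use l1 in auto)
  have "\<exists>q\<ge>m. s m - d / 2 ^ (m + 2) < l (m, q)" for m
  proof -
    have "s m - d / 2 ^ (m + 2) < s m" using d by simp
    then show ?thesis unfolding s_def using less_cSUP_iff[OF _ bdd] by auto
  qed
  \<comment> \<open>Beyond \<open>p m\<close> the limit density of the union can grow by less than
    \<open>d / 2 ^ (m + 2)\<close>; these errors sum to less than \<open>d\<close>.\<close>
  then obtain p where p: "\<And>m. p m \<ge> m" "\<And>m. s m - d / 2 ^ (m + 2) < l (m, p m)" by metis
  have "\<exists>i k. \<forall>m\<le>M. \<exists>j\<in>{m..p m}. k \<in> E i j" for M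
  proof -
    have ev: "eventually (\<lambda>i. real (card (E (r i) M - U (r i) m (p m))) < d / 2 ^ (m + 2) * N (r i)) sequentially"
      if m: "m \<le> M" for m
    proof -
      \<comment> \<open>The window up to \<open>q\<close> contains \<open>M\<close>, so its union
        contains \<open>E (r i) M\<close>, and it also extends the window up to
        \<open>p m\<close>.\<close>
      define q where "q = max M (p m)"
      have "l (m, q) \<le> s m"
        unfolding s_def by (rule cSUP_upper[OF _ bdd]) (use m in \<open>auto simp: q_def\<close>)
      then have "l (m, q) - l (m, p m) < d / 2 ^ (m + 2)" using p(2)[of m] by simp
      moreover have "(\<lambda>i. u (r i) (m, q) - u (r i) (m, p m)) \<longlonglongrightarrow> l (m, q) - l (m, p m)"
        by (intro tendsto_diff l)
      ultimately have "eventually (\<lambda>i. u (r i) (m, q) - u (r i) (m, p m) < d / 2 ^ (m + 2)) sequentially"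
        by (rule order_tendstoD(2)[rotated])
      then show ?thesis
      proof eventually_elim
        case (elim i)
        have "U (r i) m (p m) \<subseteq> U (r i) m q"
          unfolding U_def by (rule UN_mono) (auto simp: q_def)
        then have "card (U (r i) m q - U (r i) m (p m)) = card (U (r i) m q) - card (U (r i) m (p m))"
          and "card (U (r i) m (p m)) \<le> card (U (r i) m q)"
          by (auto simp: card_Diff_subset finU card_mono)
        moreover have "card (E (r i) M - U (r i) m (p m)) \<le> card (U (r i) m q - U (r i) m (p m))"
          using m by (intro card_mono finite_Diff finU) (auto simp: U_def q_def)
        ultimately have "real (card (E (r i) M - U (r i) m (p m)))
            \<le> real (card (U (r i) m q)) - real (card (U (r i) m (p m)))" by linarith
        also have "\<dots> = (u (r i) (m, q) - u (r i) (m, p m)) * real (N (r i))"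
          using pos[of "r i"] by (simp add: u_def left_diff_distrib)
        also have "\<dots> < d / 2 ^ (m + 2) * real (N (r i))"
          using elim pos[of "r i"] by (intro mult_strict_right_mono) auto
        finally show ?case .
      qed
    qed
    have "eventually (\<lambda>i. d * real (N (r i)) \<le> real (card (E (r i) M))) sequentially"
      using dens[of M] r by (rule eventually_subseq[rotated])
    moreover have "eventually (\<lambda>i. \<forall>m\<in>{..M}. real (card (E (r i) M - U (r i) m (p m))) < d / 2 ^ (m + 2) * N (r i)) sequentially"
      by (intro eventually_ball_finite) (use ev in auto)
    ultimately have "eventually (\<lambda>i. d * real (N (r i)) \<le> real (card (E (r i) M)) \<and>
        (\<forall>m\<in>{..M}. real (card (E (r i) M - U (r i) m (p m))) < d / 2 ^ (m + 2) * N (r i))) sequentially"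
      by (rule eventually_conj)
    then obtain i where i: "d * real (N (r i)) \<le> real (card (E (r i) M))"
      "\<And>m. m \<le> M \<Longrightarrow> real (card (E (r i) M - U (r i) m (p m))) < d / 2 ^ (m + 2) * N (r i)"
      by (auto simp: eventually_sequentially)
    have geo: "(\<Sum>m\<le>M. d / 2 ^ (m + 2)) < d"
    proof -
      have "(\<Sum>m\<le>M. d / 2 ^ (m + 2)) = d / 4 * (\<Sum>m\<le>M. (1/2) ^ m)"
        by (simp add: sum_distrib_left power_add power_divide field_simps)
      also have "(\<Sum>m\<le>M. (1/2::real) ^ m) = 2 - (1/2) ^ M"
        by (induction M) (auto simp: field_simps)
      also have "d / 4 * (2 - (1/2) ^ M) < d"
        using d by (simp add: field_simps) (smt (verit) mult_pos_pos zero_less_power)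
      finally show ?thesis .
    qed
    \<comment> \<open>The set \<open>E (r i) M\<close> has density at least \<open>d\<close>, more
      than all the exceptional parts together, so some \<open>k\<close> in it avoids every one of
      them.\<close>
    have "\<not> E (r i) M \<subseteq> (\<Union>m\<le>M. E (r i) M - U (r i) m (p m))"
    proof
      have fin: "finite (E (r i) M)" by (rule finite_subset[OF sub]) simp
      assume "E (r i) M \<subseteq> (\<Union>m\<le>M. E (r i) M - U (r i) m (p m))"
      then have "card (E (r i) M) \<le> card (\<Union>m\<le>M. E (r i) M - U (r i) m (p m))"
        using fin by (intro card_mono) auto
      also have "\<dots> \<le> (\<Sum>m\<le>M. card (E (r i) M - U (r i) m (p m)))"
        by (rule card_UN_le) simp
      finally have "real (card (E (r i) M)) \<le> (\<Sum>m\<le>M. real (card (E (r i) M - U (r i) m (p m))))"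
        by (metis of_nat_le_iff of_nat_sum)
      also have "\<dots> \<le> (\<Sum>m\<le>M. d / 2 ^ (m + 2) * N (r i))"
        using i(2) by (intro sum_mono) (auto intro: less_imp_le)
      also have "\<dots> < d * N (r i)"
        unfolding sum_distrib_right[symmetric]
        using geo pos[of "r i"] by (intro mult_strict_right_mono) auto
      finally show False using i(1) by simp
    qed
    then obtain k where "k \<in> E (r i) M" "\<forall>m\<le>M. k \<in> U (r i) m (p m)" by auto
    then show ?thesis unfolding U_def by blast
  qed
  then show ?thesis using that by blast
qed

section \<open>Averages along weakly null sequences\<close>

text \<open>Banach-Alaoglu: the ball is the intersection of a compact product of intervals with the
  pointwise closed set of linear functions.\<close>

lemma compact_dual_cball: "compact (dual_cball M :: ('a::real_normed_vector \<Rightarrow> real) set)"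
proof -
  have "compact (PiE UNIV (\<lambda>x::'a. {- (M * norm x)..M * norm x}))"
    using compactin_PiE[of "\<lambda>_. euclidean" UNIV "\<lambda>x::'a. {- (M * norm x)..M * norm x}"]
    by (simp add: euclidean_product_topology)
  moreover have "closed {f :: 'a \<Rightarrow> real. linear f}"
  proof -
    have "{f :: 'a \<Rightarrow> real. linear f}
        = (\<Inter>x. \<Inter>y. {f. f (x + y) = f x + f y}) \<inter> (\<Inter>c. \<Inter>x. {f. f (c *\<^sub>R x) = c * f x})"
      by (auto simp: linear_iff)
    then show ?thesis
      by (simp add: closed_INT closed_Int closed_Collect_eq continuous_on_add
          continuous_on_mult_left continuous_on_product_coordinates)
  qed
  ultimately have "compact (PiE UNIV (\<lambda>x::'a. {- (M * norm x)..M * norm x}) \<inter> {f. linear f})"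
    by (rule compact_Int_closed)
  moreover have "PiE UNIV (\<lambda>x::'a. {- (M * norm x)..M * norm x}) \<inter> {f. linear f} = dual_cball M"
    by (auto simp: dual_cball_def PiE_iff abs_le_iff minus_le_iff)
  ultimately show ?thesis by simp
qed

lemma linear_funpow:
  fixes T :: "'a::real_vector \<Rightarrow> 'a"
  shows "linear T \<Longrightarrow> linear (T ^^ k)"
proof (induction k)
  case 0 then show ?case by (simp add: linear_iff)
next
  case (Suc k) then show ?case using linear_compose[of "T ^^ k" T] by (simp add: o_def)
qed

text \<open>The uniformity over the dual ball is what later gives convergence in norm, where the
  testing functional varies with \<open>N\<close>. The power bound \<open>M\<close> keeps every
  \<open>f \<circ> T ^^ k\<close> in the compact set \<open>dual_cball M\<close>.\<close>

lemma weakly_null_average: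
  fixes T :: "'a::real_normed_vector \<Rightarrow> 'a" and n :: "nat \<Rightarrow> nat"
  assumes T: "linear T"
    and M: "\<And>k y. norm ((T ^^ k) y) \<le> M * norm y"
    and null: "\<And>g :: 'a \<Rightarrow> real. bounded_linear g \<Longrightarrow> (\<lambda>j. g ((T ^^ n j) x)) \<longlonglongrightarrow> 0"
    and e: "e > 0"
  shows "eventually (\<lambda>N. \<forall>f\<in>dual_cball 1. (\<Sum>k=1..N. \<bar>f ((T ^^ k) x)\<bar>) \<le> e * real N) sequentially"
proof (rule ccontr)
  assume "\<not> ?thesis"
  \<comment> \<open>Asking for \<open>N > i\<close> makes the lengths \<open>N i\<close> positive
    and unbounded.\<close>
  then have "\<exists>N>i. \<exists>f\<in>dual_cball 1. e * real N < (\<Sum>k=1..N. \<bar>f ((T ^^ k) x)\<bar>)" for i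
    unfolding eventually_sequentially not_ex not_all not_le
    by (metis Suc_le_eq not_le)
  then obtain N f where N: "\<And>i. N i > i" and f: "\<And>i. f i \<in> dual_cball 1"
    and big: "\<And>i. e * real (N i) < (\<Sum>k=1..N i. \<bar>f i ((T ^^ k) x)\<bar>)"
    by metis
  define C where "C = max 1 (M * norm x)"
  have C: "C > 0" "\<bar>f i ((T ^^ k) x)\<bar> \<le> C" for i k
  proof -
    show "C > 0" by (simp add: C_def)
    have "\<bar>f i ((T ^^ k) x)\<bar> \<le> norm ((T ^^ k) x)" using f by (auto simp: dual_cball_def)
    then show "\<bar>f i ((T ^^ k) x)\<bar> \<le> C" using M[of k x] by (simp add: C_def)
  qed
  define A where "A i = {k\<in>{1..N i}. e / 2 \<le> \<bar>f i ((T ^^ k) x)\<bar>}" for i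
  define E where "E i j = {k\<in>{1..N i}. e / 2 \<le> \<bar>f i ((T ^^ (k + n j)) x)\<bar>}" for i j
  \<comment> \<open>Terms outside \<open>A i\<close> contribute at most \<open>e / 2\<close> each,
    and those inside at most \<open>C\<close>; comparison with the total
    \<open>e * real (N i)\<close> leaves half of it to \<open>A i\<close>.\<close>
  have cardA: "e / (2 * C) * real (N i) \<le> real (card (A i))" for i
  proof -
    have "(\<Sum>k=1..N i. \<bar>f i ((T ^^ k) x)\<bar>) \<le> (\<Sum>k=1..N i. (if k \<in> A i then C else 0) + e / 2)"
      using C e by (intro sum_mono) (auto simp: A_def intro: add_increasing2)
    also have "\<dots> = C * real (card (A i)) + e / 2 * real (N i)"
    proof -
      have "{1..N i} \<inter> A i = A i" by (auto simp: A_def)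
      then show ?thesis by (simp add: sum.distrib sum.If_cases)
    qed
    finally have "e / 2 * real (N i) \<le> C * real (card (A i))" using big[of i] by simp
    then show ?thesis using C(1) by (simp add: field_simps)
  qed
  have dens: "eventually (\<lambda>i. e / (4 * C) * real (N i) \<le> real (card (E i j))) sequentially" for j
  proof -
    \<comment> \<open>Shifting \<open>A i\<close> down by \<open>n j\<close> loses at most the first
      \<open>n j\<close> indices. For such \<open>i\<close> these are at most
      \<open>e / (4 * C) * real (N i)\<close>, half of the lower bound for
      \<open>A i\<close>.\<close>
    have "eventually (\<lambda>i. 4 * C / e * real (n j) \<le> real i) sequentially"
      by (metis eventually_at_top_linorder filterlim_at_top filterlim_real_sequentially)
    then show ?thesis
    proof eventually_elim
      case (elim i)
      have "A i \<subseteq> {1..n j} \<union> (\<lambda>k. n j + k) ` E i j"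
      proof
        fix k assume k: "k \<in> A i"
        show "k \<in> {1..n j} \<union> (\<lambda>k. n j + k) ` E i j"
        proof (cases "k \<le> n j")
          case False
          then have "k - n j \<in> E i j" "k = n j + (k - n j)" using k by (auto simp: A_def E_def)
          then show ?thesis by blast
        qed (use k in \<open>auto simp: A_def\<close>)
      qed
      then have "card (A i) \<le> card ({1..n j} \<union> (\<lambda>k. n j + k) ` E i j)"
        by (intro card_mono) (auto simp: E_def)
      also have "\<dots> \<le> card {1..n j} + card ((\<lambda>k. n j + k) ` E i j)" by (rule card_Un_le)
      also have "\<dots> \<le> n j + card (E i j)"
        by (simp add: card_image_le E_def)
      finally have "real (card (A i)) \<le> real (n j) + real (card (E i j))" by linarith
      moreover have "real (n j) \<le> e / (4 * C) * real (N i)"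
      proof -
        have "real (n j) \<le> e / (4 * C) * real i" using elim e C(1) by (simp add: field_simps)
        also have "\<dots> \<le> e / (4 * C) * real (N i)"
          using N[of i] e C(1) by (intro mult_left_mono) auto
        finally show ?thesis .
      qed
      moreover have "e / (2 * C) * real (N i) = 2 * (e / (4 * C) * real (N i))" by simp
      ultimately show ?case using cardA[of i] by linarith
    qed
  qed
  obtain p where p: "\<And>m. \<exists>i k. \<forall>m'\<le>m. \<exists>j\<in>{m'..p m'}. k \<in> E i j"
  proof (rule density_intersections[of E N "e / (4 * C)"])
    show "E i j \<subseteq> {1..N i}" for i j by (auto simp: E_def)
    show "N i > 0" for i using N[of i] by simp
  qed (use e C(1) dens in auto)
  \<comment> \<open>Lying in every \<open>F m\<close> means being at least \<open>e / 2\<close> in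
    absolute value for infinitely many \<open>j\<close>. The finite window makes \<open>F m\<close>
    a finite union of closed sets, hence closed.\<close>
  define F where "F m = {g :: 'a \<Rightarrow> real. \<exists>j\<in>{m..p m}. e / 2 \<le> \<bar>g ((T ^^ n j) x)\<bar>}" for m
  have "dual_cball M \<inter> (\<Inter>m\<in>UNIV. F m) \<noteq> {}"
  proof (rule compact_imp_fip_image[OF compact_dual_cball])
    show "closed (F m)" for m
    proof -
      have "F m = (\<Union>j\<in>{m..p m}. {g. e / 2 \<le> \<bar>g ((T ^^ n j) x)\<bar>})"
        by (auto simp: F_def)
      moreover have "closed {g :: 'a \<Rightarrow> real. e / 2 \<le> \<bar>g z\<bar>}" for z
        by (intro closed_Collect_le continuous_intros continuous_on_product_coordinates)
      ultimately show ?thesis by (auto intro!: closed_UN)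
    qed
    fix I :: "nat set" assume "finite I"
    then obtain m where m: "I \<subseteq> {..m}" by (meson finite_nat_iff_bounded_le)
    obtain i k where ik: "\<And>m'. m' \<le> m \<Longrightarrow> \<exists>j\<in>{m'..p m'}. k \<in> E i j" using p by metis
    let ?g = "\<lambda>y. f i ((T ^^ k) y)"
    have "linear (T ^^ k)" by (rule linear_funpow[OF T])
    then have "linear ?g"
      using linear_compose[of "T ^^ k" "f i"] f[of i] by (auto simp: o_def dual_cball_def)
    moreover have "\<bar>?g y\<bar> \<le> M * norm y" for y
    proof -
      have "\<bar>?g y\<bar> \<le> norm ((T ^^ k) y)" using f[of i] by (auto simp: dual_cball_def)
      then show ?thesis using M[of k y] by simp
    qed
    ultimately have "?g \<in> dual_cball M" by (simp add: dual_cball_def)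
    moreover have "?g \<in> F m'" if m': "m' \<in> I" for m'
    proof -
      obtain j where "j \<in> {m'..p m'}" "k \<in> E i j" using ik[of m'] subsetD[OF m m'] by auto
      then show ?thesis using \<open>?g \<in> dual_cball M\<close>
        by (auto simp: F_def E_def funpow_add)
    qed
    ultimately show "dual_cball M \<inter> (\<Inter>m\<in>I. F m) \<noteq> {}" by blast
  qed
  then obtain g where g: "g \<in> dual_cball M" "\<And>m. g \<in> F m" by blast
  have "eventually (\<lambda>j. \<bar>g ((T ^^ n j) x)\<bar> < e / 2) sequentially"
    using tendstoD[OF null[OF dual_cball_bounded_linear[OF g(1)]], of "e / 2"] e by simp
  then obtain m where "\<And>j. j \<ge> m \<Longrightarrow> \<bar>g ((T ^^ n j) x)\<bar> < e / 2"
    by (auto simp: eventually_sequentially)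
  moreover obtain j where "j \<ge> m" "e / 2 \<le> \<bar>g ((T ^^ n j) x)\<bar>" using g(2)[of m] by (auto simp: F_def)
  ultimately show False by force
qed

section \<open>Weakly compact orbits\<close>

text \<open>The sequence \<open>h\<close> enumerates the finite rational combinations of the
  \<open>y k\<close>, coded as lists of index and coefficient. Their closure is also stable under
  real scalars, by rational approximation.\<close>

lemma countable_dense_subspace:
  fixes y :: "nat \<Rightarrow> 'a::real_normed_vector"
  obtains h :: "nat \<Rightarrow> 'a" where "subspace (closure (range h))" "\<And>k. y k \<in> closure (range h)"
proof -
  define c :: "(nat \<times> rat) list \<Rightarrow> 'a"
    where "c l = sum_list (map (\<lambda>(k, q). of_rat q *\<^sub>R y k) l)" for l
  define h :: "nat \<Rightarrow> 'a" where "h m = c (from_nat m)" for m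
  have D: "range h = range c"
    unfolding h_def by (auto simp: image_iff) (metis from_nat_to_nat)
  have add: "u + v \<in> range c" if uv: "u \<in> range c" "v \<in> range c" for u v
  proof -
    obtain l l' where "u = c l" "v = c l'" using uv by blast
    then have "u + v = c (l @ l')" by (simp add: c_def)
    then show ?thesis by blast
  qed
  have scale: "of_rat q *\<^sub>R u \<in> range c" if u: "u \<in> range c" for q u
  proof -
    obtain l where "u = c l" using u by blast
    moreover have "of_rat q *\<^sub>R c l = c (map (\<lambda>(k, r). (k, q * r)) l)" for l
      by (induction l) (auto simp: c_def scaleR_add_right of_rat_mult)
    ultimately show ?thesis by blast
  qed
  have "subspace (closure (range c))"
    unfolding subspace_def
  proof (intro conjI ballI allI)
    have "c [] \<in> closure (range c)" by (intro subsetD[OF closure_subset] rangeI)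
    then show "0 \<in> closure (range c)" by (simp add: c_def)
  next
    fix u v assume "u \<in> closure (range c)" "v \<in> closure (range c)"
    then obtain s t where s: "\<And>i. s i \<in> range c" "s \<longlonglongrightarrow> u" and t: "\<And>i. t i \<in> range c" "t \<longlonglongrightarrow> v"
      unfolding closure_sequential by blast
    have "(\<lambda>i. s i + t i) \<longlonglongrightarrow> u + v" by (intro tendsto_add s t)
    moreover have "\<forall>i. s i + t i \<in> range c" using add[OF s(1) t(1)] by simp
    ultimately show "u + v \<in> closure (range c)"
      unfolding closure_sequential by (intro exI[of _ "\<lambda>i. s i + t i"] conjI)
  next
    fix b :: real and u assume "u \<in> closure (range c)"
    then obtain s where s: "\<And>i. s i \<in> range c" "s \<longlonglongrightarrow> u"
      unfolding closure_sequential by blast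
    have "\<exists>q. b < of_rat q \<and> of_rat q < b + 1 / real (Suc i)" for i
      by (rule of_rat_dense) simp
    then obtain q where q: "\<And>i. b < of_rat (q i)" "\<And>i. of_rat (q i) < b + 1 / real (Suc i)"
      by metis
    have "(\<lambda>i. b + 1 / real (Suc i)) \<longlonglongrightarrow> b + 0"
      by (intro tendsto_intros lim_inverse_n' LIMSEQ_Suc)
    then have "(\<lambda>i. of_rat (q i)) \<longlonglongrightarrow> b + 0"
      by (rule tendsto_sandwich[of "\<lambda>_. b", rotated 3])
        (use q[THEN less_imp_le] in \<open>auto intro!: always_eventually simp del: of_nat_Suc\<close>)
    then have "(\<lambda>i. of_rat (q i) *\<^sub>R s i) \<longlonglongrightarrow> b *\<^sub>R u"
      using tendsto_scaleR[OF _ s(2)] by fastforce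
    moreover have "\<forall>i. of_rat (q i) *\<^sub>R s i \<in> range c" using scale[OF s(1)] by simp
    ultimately show "b *\<^sub>R u \<in> closure (range c)"
      unfolding closure_sequential by (intro exI[of _ "\<lambda>i. of_rat (q i) *\<^sub>R s i"] conjI)
  qed
  moreover have "y k \<in> closure (range c)" for k
  proof -
    have "c [(k, 1)] \<in> closure (range c)" by (intro subsetD[OF closure_subset] rangeI)
    then show ?thesis by (simp add: c_def)
  qed
  ultimately show ?thesis using that[of h] D by simp
qed

text \<open>Only continuity of the real functionals is recorded, so that one argument covers the
  weak topologies of real and of complex spaces.\<close>

definition finer_than_weak :: "'a::real_normed_vector topology \<Rightarrow> bool" where
  "finer_than_weak W \<longleftrightarrow> (\<forall>(g :: 'a \<Rightarrow> real) U. bounded_linear g \<longrightarrow> open U \<longrightarrow> openin W (g -` U))"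

section \<open>Compactness when all bounded real functionals are continuous\<close>

lemma finer_than_weakD:
  fixes g :: "'a::real_normed_vector \<Rightarrow> real"
  shows "finer_than_weak W \<Longrightarrow> bounded_linear g \<Longrightarrow> open U \<Longrightarrow> openin W (g -` U)"
  by (simp add: finer_than_weak_def)

lemma finer_than_weak_topspace:
  fixes W :: "'a::real_normed_vector topology"
  assumes "finer_than_weak W" shows "topspace W = UNIV"
  using finer_than_weakD[OF assms bounded_linear_zero open_UNIV] openin_subset by fastforce

text \<open>Otherwise the open sets that the sequence eventually leaves would cover
  \<open>C\<close>, and some term would lie outside a whole finite subcover. Clustering is expressed
  for one functional at a time.\<close>

lemma compactin_cluster_point:
  fixes W :: "'a::real_normed_vector topology"
  assumes W: "finer_than_weak W" and C: "compactin W C" and y: "\<And>i. y i \<in> C"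
  shows "\<exists>z. \<forall>(g :: 'a \<Rightarrow> real) e N. bounded_linear g \<longrightarrow> e > 0 \<longrightarrow> (\<exists>i\<ge>N::nat. \<bar>g (y i) - g z\<bar> < e)"
proof (rule ccontr)
  assume no: "\<not> ?thesis"
  define \<U> where "\<U> = {U. openin W U \<and> eventually (\<lambda>i. y i \<notin> U) sequentially}"
  have "z \<in> \<Union>\<U>" for z
  proof -
    obtain g :: "'a \<Rightarrow> real" and e N where g: "bounded_linear g" "e > 0" "\<And>i. i \<ge> N \<Longrightarrow> \<not> \<bar>g (y i) - g z\<bar> < e"
      using no by blast
    have "z \<in> g -` ball (g z) e" using g(2) by simp
    moreover have "g -` ball (g z) e \<in> \<U>"
      using finer_than_weakD[OF W g(1) open_ball] g(3)
      by (auto simp: \<U>_def eventually_sequentially dist_real_def abs_minus_commute)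
    ultimately show ?thesis by (rule UnionI[rotated])
  qed
  then have "C \<subseteq> \<Union>\<U>" by blast
  then obtain \<F> where F: "finite \<F>" "\<F> \<subseteq> \<U>" "C \<subseteq> \<Union>\<F>"
    using compactinD[OF C, of \<U>] by (auto simp: \<U>_def)
  have "eventually (\<lambda>i. \<forall>U\<in>\<F>. y i \<notin> U) sequentially"
    using F by (intro eventually_ball_finite) (auto simp: \<U>_def)
  then obtain i where "\<forall>U\<in>\<F>. y i \<notin> U" by (auto simp: eventually_sequentially)
  then show False using F(3) y[of i] by auto
qed

lemma compactin_functional_bounded:
  fixes g :: "'a::real_normed_vector \<Rightarrow> real"
  assumes W: "finer_than_weak W" and C: "compactin W C" and g: "bounded_linear g"
  obtains B where "\<And>y. y \<in> C \<Longrightarrow> \<bar>g y\<bar> \<le> B"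
proof -
  have "continuous_map W euclidean g"
    unfolding continuous_map_def using finer_than_weakD[OF W g] finer_than_weak_topspace[OF W]
    by (auto simp: vimage_def)
  then have "compact (g ` C)" using image_compactin[OF C] by fastforce
  then show ?thesis using that compact_imp_bounded by (force simp: bounded_iff)
qed

lemma weak_closure_zero_approx:
  fixes G :: "('a::real_normed_vector \<Rightarrow> real) set"
  assumes W: "finer_than_weak W" and z: "0 \<in> W closure_of S"
    and G: "finite G" "\<And>g. g \<in> G \<Longrightarrow> bounded_linear g" and e: "e > 0"
  obtains s where "s \<in> S" "\<And>g. g \<in> G \<Longrightarrow> \<bar>g s\<bar> < e"
proof -
  have "openin W (\<Inter>g\<in>G. g -` ball 0 e)" if "G \<noteq> {}"
    using that G finer_than_weakD[OF W _ open_ball] by (intro openin_INT2) auto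
  then have "openin W (\<Inter>g\<in>G. g -` ball 0 e)"
    using openin_topspace[of W] finer_than_weak_topspace[OF W] by (cases "G = {}") auto
  moreover have "0 \<in> (\<Inter>g\<in>G. g -` ball 0 e)"
    using G(2) e by (auto simp: bounded_linear.linear linear_0)
  ultimately obtain s where "s \<in> S" "s \<in> (\<Inter>g\<in>G. g -` ball 0 e)"
    using z unfolding in_closure_of by blast
  then show ?thesis using that by auto
qed

text \<open>A case of the Eberlein--Smulian theorem: the closed span of the sequence is separable, so countably
  many functionals separate its points, and a sequence of its terms along which they tend to 0 has 0
  as its only weak cluster point. The indices \<open>n j\<close> need not increase.\<close>

lemma weakly_null_subsequence:
  fixes y :: "nat \<Rightarrow> 'a::real_normed_vector"
  assumes W: "finer_than_weak W" and C: "compactin W (W closure_of range y)"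
    and z: "0 \<in> W closure_of range y"
  obtains n :: "nat \<Rightarrow> nat" where "\<And>g :: 'a \<Rightarrow> real. bounded_linear g \<Longrightarrow> (\<lambda>j. g (y (n j))) \<longlonglongrightarrow> 0"
proof -
  obtain h :: "nat \<Rightarrow> 'a" where h: "subspace (closure (range h))" "\<And>k. y k \<in> closure (range h)"
    using countable_dense_subspace by blast
  have "\<exists>\<psi>. \<psi> \<in> dual_cball 1 \<and> \<psi> (h m) = norm (h m)" for m
    using norming_functional by metis
  then obtain \<psi> where \<psi>: "\<And>m. \<psi> m \<in> dual_cball 1" "\<And>m. \<psi> m (h m) = norm (h m)" by metis
  \<comment> \<open>The first \<open>j + 1\<close> norming functionals define a weak neighbourhood
    of 0, which the sequence meets; the limit along the chosen indices is therefore 0 for every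
    \<open>\<psi> m\<close>.\<close>
  have "\<exists>k. \<forall>m\<le>j. \<bar>\<psi> m (y k)\<bar> < 1 / real (Suc j)" for j
  proof -
    obtain s where "s \<in> range y" "\<And>g. g \<in> \<psi> ` {..j} \<Longrightarrow> \<bar>g s\<bar> < 1 / real (Suc j)"
    proof (rule weak_closure_zero_approx[OF W z])
      show "bounded_linear g" if "g \<in> \<psi> ` {..j}" for g
        using that dual_cball_bounded_linear[OF \<psi>(1)] by auto
    qed auto
    then show ?thesis by auto
  qed
  then obtain n where n: "\<And>j m. m \<le> j \<Longrightarrow> \<bar>\<psi> m (y (n j))\<bar> < 1 / real (Suc j)" by metis
  have "(\<lambda>j. g (y (n j))) \<longlonglongrightarrow> 0" if g: "bounded_linear g" for g :: "'a \<Rightarrow> real"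
  proof (rule ccontr)
    assume "\<not> ?thesis"
    then obtain e where e: "e > 0" "\<not> eventually (\<lambda>j. dist (g (y (n j))) 0 < e) sequentially"
      unfolding tendsto_iff by blast
    then obtain r :: "nat \<Rightarrow> nat" where r: "strict_mono r" "\<And>i. \<not> dist (g (y (n (r i)))) 0 < e"
      using not_eventually_sequentiallyD[OF e(2)] by blast
    have "y (n (r i)) \<in> W closure_of range y" for i
      using closure_of_subset[of "range y" W] finer_than_weak_topspace[OF W] by auto
    then obtain z where cl: "\<And>(f :: 'a \<Rightarrow> real) e N. bounded_linear f \<Longrightarrow> e > 0
        \<Longrightarrow> \<exists>i\<ge>N. \<bar>f (y (n (r i))) - f z\<bar> < e"
      using compactin_cluster_point[OF W C, of "\<lambda>i. y (n (r i))"] by metis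
    \<comment> \<open>A functional that vanishes on the closed span but not at \<open>z\<close>
      would stay away from its value at \<open>z\<close> along the whole sequence.\<close>
    have zS: "z \<in> closure (range h)"
    proof (rule ccontr)
      assume "z \<notin> closure (range h)"
      then obtain f :: "'a \<Rightarrow> real" where f: "bounded_linear f"
        "\<And>s. s \<in> closure (range h) \<Longrightarrow> f s = 0" "f z \<noteq> 0"
        using separating_functional[OF h(1) closed_closure] by blast
      then show False using cl[of f "\<bar>f z\<bar>" 0] h(2) by auto
    qed
    have \<psi>0: "\<psi> m z = 0" for m
    proof -
      have "\<bar>\<psi> m z\<bar> \<le> 0 + d" if d: "d > 0" for d
      proof -
        obtain K where K: "1 / real (Suc K) < d / 2" using d nat_approx_posE half_gt_zero by metis
        obtain i where i: "i \<ge> max m K" "\<bar>\<psi> m (y (n (r i))) - \<psi> m z\<bar> < d / 2"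
          using cl[OF dual_cball_bounded_linear[OF \<psi>(1)], of "d / 2" "max m K" m] d by auto
        have ri: "i \<le> r i" using r(1) by (rule seq_suble)
        then have "\<bar>\<psi> m (y (n (r i)))\<bar> < 1 / real (Suc (r i))" using i(1) by (intro n) auto
        also have "\<dots> \<le> 1 / real (Suc K)" using i(1) ri by (intro divide_left_mono) auto
        finally show ?thesis using i(2) K by linarith
      qed
      then have "\<bar>\<psi> m z\<bar> \<le> 0" by (rule field_le_epsilon)
      then show ?thesis by simp
    qed
    \<comment> \<open>Since \<open>\<psi> m\<close> norms \<open>h m\<close> and kills
      \<open>z\<close>, the norm of \<open>h m\<close> is at most its distance to \<open>z\<close>,
      which density makes small.\<close>
    have "norm z \<le> 0 + d" if d: "d > 0" for d
    proof -
      obtain m where m: "dist (h m) z < d / 2"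
        using zS d by (auto simp: closure_approachable dest!: spec[of _ "d / 2"])
      have "norm (h m) = \<psi> m (h m - z)"
        using \<psi>0[of m] \<psi>(2)[of m] \<psi>(1)[of m] by (simp add: dual_cball_def linear_diff)
      also have "\<dots> \<le> norm (h m - z)" using \<psi>(1)[of m] by (auto simp: dual_cball_def abs_le_iff)
      finally show ?thesis using m norm_triangle_sub[of z "h m"] by (simp add: dist_norm norm_minus_commute)
    qed
    then have "norm z \<le> 0" by (rule field_le_epsilon)
    then have "g z = 0" using g by (simp add: bounded_linear.linear linear_0)
    then show False using cl[OF g e(1), of 0] r(2) by auto
  qed
  then show ?thesis using that by blast
qed

text \<open>Uniform boundedness enters twice: functionals are bounded on the compact orbit closure,
  so each orbit is norm bounded, and then the powers of \<open>T\<close> are bounded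
  uniformly.\<close>

lemma power_bounded_of_weakly_compact_orbits:
  fixes T :: "'a::banach \<Rightarrow> 'a"
  assumes W: "finer_than_weak W" and T: "bounded_linear T"
    and C: "\<And>x. compactin W (W closure_of orbit T x)"
  obtains M where "\<And>k x. norm ((T ^^ k) x) \<le> M * norm x"
proof (rule uniform_boundedness[of "\<lambda>k. T ^^ k"])
  show "bounded_linear (T ^^ k)" for k
  proof (induction k)
    case 0 then show ?case by (simp add: bounded_linear_ident id_def)
  next
    case (Suc k) then show ?case using bounded_linear_compose[OF T] by (simp add: o_def)
  qed
  show "\<exists>B. \<forall>k. norm ((T ^^ k) x) \<le> B" for x
  proof -
    have "\<exists>B. \<forall>k. \<bar>g ((T ^^ k) x)\<bar> \<le> B" if g: "bounded_linear g" for g :: "'a \<Rightarrow> real"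
    proof -
      obtain B where "\<And>y. y \<in> W closure_of orbit T x \<Longrightarrow> \<bar>g y\<bar> \<le> B"
        using compactin_functional_bounded[OF W C g] by metis
      moreover have "(T ^^ k) x \<in> W closure_of orbit T x" for k
        using closure_of_subset[of "orbit T x" W] finer_than_weak_topspace[OF W]
        by (auto simp: orbit_def)
      ultimately show ?thesis by blast
    qed
    then show ?thesis using weakly_bounded_imp_bounded[of "\<lambda>k. (T ^^ k) x"] by metis
  qed
qed (use that in blast)

section \<open>Weighted averages\<close>

lemma weighted_average_tendsto_zero:
  fixes y :: "nat \<Rightarrow> 'a::real_normed_vector" and a :: "nat \<Rightarrow> real" and \<phi> :: "real \<Rightarrow> real"
  assumes unif: "\<And>e. e > 0 \<Longrightarrow>
      eventually (\<lambda>N. \<forall>f\<in>dual_cball 1. (\<Sum>k=1..N. \<bar>f (y k)\<bar>) \<le> e * real N) sequentially"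
    and C: "\<And>k. norm (y k) \<le> C"
    and \<phi>0: "\<phi> \<in> {0..} \<rightarrow> {0..}" and mono: "mono_on {0..} \<phi>" and top: "filterlim \<phi> at_top at_top"
    and bdd: "bdd_above ((\<lambda>n. (1 / real n) * (\<Sum>k=1..n. \<bar>a k\<bar> * \<phi> \<bar>a k\<bar>)) ` {1..})"
  shows "(\<lambda>n. norm ((1 / real n) *\<^sub>R (\<Sum>k=1..n. a k *\<^sub>R y k))) \<longlonglongrightarrow> 0"
proof (rule LIMSEQ_I)
  fix \<epsilon> :: real assume \<epsilon>: "\<epsilon> > 0"
  have C0: "C \<ge> 0" using C[of 0] norm_ge_zero[of "y 0"] by linarith
  obtain B where B: "\<And>n. n \<ge> 1 \<Longrightarrow> (1 / real n) * (\<Sum>k=1..n. \<bar>a k\<bar> * \<phi> \<bar>a k\<bar>) \<le> B"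
    using bdd by (auto simp: bdd_above_def)
  \<comment> \<open>This level keeps the contribution of the large weights below
    \<open>\<epsilon> / 4\<close>; \<open>L \<ge> 1\<close> puts it in the domain where
    \<open>\<phi>\<close> is monotone and allows division by \<open>L\<close>.\<close>
  have "eventually (\<lambda>L. 4 * C * \<bar>B\<bar> / \<epsilon> < \<phi> L) at_top"
    using top by (simp add: filterlim_at_top_dense)
  then have "eventually (\<lambda>L. 4 * C * \<bar>B\<bar> / \<epsilon> < \<phi> L \<and> L \<ge> 1) at_top"
    using eventually_ge_at_top by (rule eventually_conj)
  then obtain L where L: "4 * C * \<bar>B\<bar> / \<epsilon> < \<phi> L" "L \<ge> 1"
    using eventually_happens'[OF trivial_limit_at_top_linorder] by blast
  have "0 \<le> 4 * C * \<bar>B\<bar> / \<epsilon>" using C0 \<epsilon> by simp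
  then have \<phi>L: "\<phi> L > 0" using L(1) by linarith
  \<comment> \<open>The first term covers weights up to \<open>L\<close>. For larger ones
    \<open>\<phi> \<bar>a k\<bar> / \<phi> L\<close> is at least 1, so the second term
    suffices.\<close>
  have pt: "a k * f (y k) \<le> L * \<bar>f (y k)\<bar> + C / \<phi> L * (\<bar>a k\<bar> * \<phi> \<bar>a k\<bar>)" if f: "f \<in> dual_cball 1" for f k
  proof -
    have "\<bar>f (y k)\<bar> \<le> norm (y k)" using f by (auto simp: dual_cball_def)
    then have fC: "\<bar>f (y k)\<bar> \<le> C" using C[of k] by simp
    have nn: "0 \<le> \<bar>a k\<bar> * \<phi> \<bar>a k\<bar>" using \<phi>0 by (auto simp: Pi_iff)
    have "a k * f (y k) \<le> \<bar>a k\<bar> * \<bar>f (y k)\<bar>" by (metis abs_ge_self abs_mult)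
    also have "\<dots> \<le> L * \<bar>f (y k)\<bar> + C / \<phi> L * (\<bar>a k\<bar> * \<phi> \<bar>a k\<bar>)"
    proof (cases "\<bar>a k\<bar> \<le> L")
      case True
      then have "\<bar>a k\<bar> * \<bar>f (y k)\<bar> \<le> L * \<bar>f (y k)\<bar>" by (intro mult_right_mono) auto
      moreover have "0 \<le> C / \<phi> L * (\<bar>a k\<bar> * \<phi> \<bar>a k\<bar>)" 
        using C0 \<phi>L by (intro mult_nonneg_nonneg[OF _ nn]) simp
      ultimately show ?thesis by linarith
    next
      case False
      then have "\<phi> L \<le> \<phi> \<bar>a k\<bar>" using L(2) by (intro mono_onD[OF mono]) auto
      then have "1 \<le> \<phi> \<bar>a k\<bar> / \<phi> L" using \<phi>L by simp
      then have "(C * \<bar>a k\<bar>) * 1 \<le> (C * \<bar>a k\<bar>) * (\<phi> \<bar>a k\<bar> / \<phi> L)"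
        using C0 by (intro mult_left_mono) auto
      moreover have "\<bar>a k\<bar> * \<bar>f (y k)\<bar> \<le> \<bar>a k\<bar> * C" using fC by (intro mult_left_mono) auto
      moreover have "0 \<le> L * \<bar>f (y k)\<bar>" using L(2) by simp
      ultimately show ?thesis by (simp add: mult_ac)
    qed
    finally show ?thesis .
  qed
  have "eventually (\<lambda>N. \<forall>f\<in>dual_cball 1. (\<Sum>k=1..N. \<bar>f (y k)\<bar>) \<le> \<epsilon> / (2 * L) * real N) sequentially"
    using \<epsilon> L(2) by (intro unif) auto
  then obtain N0 where N0: "\<And>N f. N \<ge> N0 \<Longrightarrow> f \<in> dual_cball 1 \<Longrightarrow> (\<Sum>k=1..N. \<bar>f (y k)\<bar>) \<le> \<epsilon> / (2 * L) * real N"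
    by (auto simp: eventually_sequentially)
  show "\<exists>no. \<forall>n\<ge>no. norm (norm ((1 / real n) *\<^sub>R (\<Sum>k=1..n. a k *\<^sub>R y k)) - 0) < \<epsilon>"
  proof (intro exI allI impI)
    fix n assume n: "n \<ge> max 1 N0"
    define S where "S = (\<Sum>k=1..n. a k *\<^sub>R y k)"
    \<comment> \<open>This functional changes with \<open>n\<close>; the estimate from
      \<open>N0\<close> holds for all of them simultaneously.\<close>
    obtain f where f: "f \<in> dual_cball 1" "f S = norm S" by (rule norming_functional)
    have "norm S = (\<Sum>k=1..n. a k * f (y k))"
      using f by (simp add: S_def dual_cball_def linear_sum linear_cmul flip: f(2))
    also have "\<dots> \<le> (\<Sum>k=1..n. L * \<bar>f (y k)\<bar> + C / \<phi> L * (\<bar>a k\<bar> * \<phi> \<bar>a k\<bar>))"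
      by (intro sum_mono pt f)
    also have "\<dots> = L * (\<Sum>k=1..n. \<bar>f (y k)\<bar>) + C / \<phi> L * (\<Sum>k=1..n. \<bar>a k\<bar> * \<phi> \<bar>a k\<bar>)"
      by (simp add: sum.distrib sum_distrib_left)
    also have "\<dots> \<le> L * (\<epsilon> / (2 * L) * real n) + C / \<phi> L * (\<bar>B\<bar> * real n)"
    proof (intro add_mono mult_left_mono)
      show "(\<Sum>k=1..n. \<bar>f (y k)\<bar>) \<le> \<epsilon> / (2 * L) * real n" using N0 n f(1) by simp
      have "(\<Sum>k=1..n. \<bar>a k\<bar> * \<phi> \<bar>a k\<bar>) \<le> B * real n" using B[of n] n by (simp add: field_simps)
      also have "\<dots> \<le> \<bar>B\<bar> * real n" by (intro mult_right_mono) auto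
      finally show "(\<Sum>k=1..n. \<bar>a k\<bar> * \<phi> \<bar>a k\<bar>) \<le> \<bar>B\<bar> * real n" .
    qed (use L(2) C0 \<phi>L in auto)
    also have "L * (\<epsilon> / (2 * L) * real n) = \<epsilon> / 2 * real n" using L(2) by simp
    also have "C / \<phi> L * (\<bar>B\<bar> * real n) \<le> \<epsilon> / 4 * real n"
    proof -
      have "C * \<bar>B\<bar> \<le> \<epsilon> / 4 * \<phi> L" using L(1) \<epsilon> by (simp add: field_simps)
      then have "C / \<phi> L * \<bar>B\<bar> \<le> \<epsilon> / 4" using \<phi>L by (simp add: field_simps)
      then show ?thesis using mult_right_mono[of "C / \<phi> L * \<bar>B\<bar>" "\<epsilon> / 4" "real n"] by (simp add: mult_ac)
    qed
    finally have "norm S \<le> 3 / 4 * \<epsilon> * real n" by simp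
    then have "norm ((1 / real n) *\<^sub>R S) \<le> 3 / 4 * \<epsilon>" using n by (simp add: field_simps)
    then have "norm ((1 / real n) *\<^sub>R S) < \<epsilon>" using \<epsilon> by linarith
    then show "norm (norm ((1 / real n) *\<^sub>R (\<Sum>k=1..n. a k *\<^sub>R y k)) - 0) < \<epsilon>"
      by (simp add: S_def)
  qed
qed

section \<open>Weak topologies over real and complex scalars\<close>

lemma finer_than_weak_real: "finer_than_weak (weak_topology (scaleR :: real \<Rightarrow> 'a::real_normed_vector \<Rightarrow> 'a))"
  unfolding finer_than_weak_def
proof (intro allI impI)
  fix g :: "'a \<Rightarrow> real" and U :: "real set" assume g: "bounded_linear g" and U: "open U"
  have "bounded_linear_over scaleR (*) g"
    using g by (simp add: bounded_linear_over_def bounded_linear.linear linear_cmul)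
  then show "openin (weak_topology (scaleR :: real \<Rightarrow> 'a \<Rightarrow> 'a)) (g -` U)"
    unfolding weak_topology_def using U by (intro topology_generated_by_Basis) blast
qed

context complex_normed_space
begin

lemma smul_ii_scaleR: "smul \<i> (r *\<^sub>R x) = r *\<^sub>R smul \<i> x"
  unfolding smul_of_real[symmetric] by (rule scale_left_commute)

text \<open>With \<open>smul \<i>\<close> outermost, a complex weighted average becomes one real
  weighted average plus the isometric image of another.\<close>

lemma smul_eq_Re_Im: "smul c x = Re c *\<^sub>R x + smul \<i> (Im c *\<^sub>R x)"
proof -
  have "smul c x = smul (of_real (Re c) + \<i> * of_real (Im c)) x"
    by (simp flip: complex_eq)
  then show ?thesis by (simp add: scale_left_distrib smul_of_real flip: scale_scale)
qed

end

text \<open>Every bounded real functional \<open>g\<close> is the real part of the complex linear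
  functional with imaginary part \<open>- g (smul \<i> x)\<close>, so preimages under
  \<open>g\<close> are weakly open.\<close>

lemma finer_than_weak_complex:
  assumes "complex_normed_space smul"
  shows "finer_than_weak (weak_topology smul)"
  unfolding finer_than_weak_def
proof (intro allI impI)
  interpret complex_normed_space smul by fact
  fix g :: "'a \<Rightarrow> real" and U :: "real set" assume g: "bounded_linear g" and U: "open U"
  define f where "f x = Complex (g x) (- g (smul \<i> x))" for x
  have i: "bounded_linear (smul \<i>)"
  proof (rule bounded_linear_intro[where K = 1])
    show "smul \<i> (r *\<^sub>R x) = r *\<^sub>R smul \<i> x" for r x by (rule smul_ii_scaleR)
  qed (simp_all add: scale_right_distrib norm_smul)
  have ii: "smul \<i> (smul \<i> x) = - x" for x
    using smul_of_real[of "-1" x] by simp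
  note gl = bounded_linear.linear[OF g]
  have gi: "bounded_linear (\<lambda>x. g (smul \<i> x))" by (rule bounded_linear_compose[OF g i])
  have "bounded_linear f"
  proof -
    have "f = (\<lambda>x. complex_of_real (g x) + complex_of_real (- g (smul \<i> x)) * \<i>)"
      by (auto simp: f_def complex_eq_iff)
    moreover have "bounded_linear \<dots>"
      by (intro bounded_linear_add bounded_linear_mult_const
          bounded_linear_compose[OF bounded_linear_of_real] bounded_linear_minus g gi)
    ultimately show ?thesis by simp
  qed
  moreover have "f (smul c x) = c * f x" for c x
  proof -
    have "smul \<i> (smul c x) = Re c *\<^sub>R smul \<i> x - Im c *\<^sub>R x"
      unfolding smul_eq_Re_Im[of c x]
      using i ii by (simp add: bounded_linear.linear linear_add linear_cmul)
    then show ?thesis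
      unfolding f_def complex_eq_iff
      using gl smul_eq_Re_Im[of c x] by (simp add: smul_ii_scaleR linear_add linear_diff linear_cmul)
  qed
  ultimately have "bounded_linear_over smul (*) f" by (simp add: bounded_linear_over_def)
  moreover have "g -` U = f -` (Re -` U)" by (auto simp: f_def)
  moreover have "open (Re -` U)" using U by (intro open_vimage continuous_intros) auto
  ultimately show "openin (weak_topology smul) (g -` U)"
    unfolding weak_topology_def by (intro topology_generated_by_Basis) blast
qed

text \<open>The weights are real but \<open>W\<close> is any topology finer than the weak one, so a
  complex space can be treated here through its underlying real structure.\<close>

lemma flight_vector_weighted_average:
  fixes T :: "'a::banach \<Rightarrow> 'a" and a :: "nat \<Rightarrow> real"
  assumes W: "finer_than_weak W" and T: "bounded_linear T"
    and C: "\<And>x. compactin W (W closure_of orbit T x)"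
    and x: "0 \<in> W closure_of orbit T x"
    and \<phi>: "\<phi> \<in> {0..} \<rightarrow> {0..}" "mono_on {0..} \<phi>" "filterlim \<phi> at_top at_top"
    and bdd: "bdd_above ((\<lambda>n. (1 / real n) * (\<Sum>k=1..n. \<bar>a k\<bar> * \<phi> \<bar>a k\<bar>)) ` {1..})"
  shows "(\<lambda>n. norm ((1 / real n) *\<^sub>R (\<Sum>k=1..n. a k *\<^sub>R (T ^^ k) x))) \<longlonglongrightarrow> 0"
proof -
  obtain M where M: "\<And>k x. norm ((T ^^ k) x) \<le> M * norm x"
    using power_bounded_of_weakly_compact_orbits[OF W T C] by blast
  obtain n where n: "\<And>g :: 'a \<Rightarrow> real. bounded_linear g \<Longrightarrow> (\<lambda>j. g ((T ^^ n j) x)) \<longlonglongrightarrow> 0"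
    using weakly_null_subsequence[OF W, of "\<lambda>k. (T ^^ k) x"] C[of x] x by (metis orbit_def)
  show ?thesis
  proof (rule weighted_average_tendsto_zero[OF _ M \<phi> bdd])
    fix e :: real assume "e > 0"
    then show "eventually (\<lambda>N. \<forall>f\<in>dual_cball 1. (\<Sum>k=1..N. \<bar>f ((T ^^ k) x)\<bar>) \<le> e * real N) sequentially"
      by (intro weakly_null_average[where M = M and n = n] bounded_linear.linear[OF T] M n)
  qed
qed

text \<open>On nonnegative arguments the product of \<open>t\<close> with \<open>\<phi> t\<close> is
  monotone. This transfers the growth condition from the moduli of complex weights to their real and
  imaginary parts.\<close>

lemma bdd_above_average_mono:
  fixes a b :: "nat \<Rightarrow> real" and \<phi> :: "real \<Rightarrow> real"
  assumes \<phi>: "\<phi> \<in> {0..} \<rightarrow> {0..}" "mono_on {0..} \<phi>"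
    and ab: "\<And>k. \<bar>a k\<bar> \<le> b k"
    and bdd: "bdd_above ((\<lambda>n. (1 / real n) * (\<Sum>k=1..n. b k * \<phi> (b k))) ` {1..})"
  shows "bdd_above ((\<lambda>n. (1 / real n) * (\<Sum>k=1..n. \<bar>a k\<bar> * \<phi> \<bar>a k\<bar>)) ` {1..})"
proof -
  obtain B where B: "\<And>n. n \<ge> 1 \<Longrightarrow> (1 / real n) * (\<Sum>k=1..n. b k * \<phi> (b k)) \<le> B"
    using bdd by (auto simp: bdd_above_def)
  have "\<bar>a k\<bar> * \<phi> \<bar>a k\<bar> \<le> b k * \<phi> (b k)" for k
  proof (rule mult_mono)
    show "\<bar>a k\<bar> \<le> b k" by (rule ab)
    have "0 \<le> b k" using ab[of k] abs_ge_zero[of "a k"] by linarith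
    then show "\<phi> \<bar>a k\<bar> \<le> \<phi> (b k)" "0 \<le> b k" using ab[of k] by (auto intro: mono_onD[OF \<phi>(2)])
    show "0 \<le> \<phi> \<bar>a k\<bar>" using \<phi>(1) by (auto simp: Pi_iff)
  qed
  then have "(1 / real n) * (\<Sum>k=1..n. \<bar>a k\<bar> * \<phi> \<bar>a k\<bar>) \<le> (1 / real n) * (\<Sum>k=1..n. b k * \<phi> (b k))" for n
    by (intro mult_left_mono sum_mono) auto
  then show ?thesis using B by (intro bdd_aboveI2[of _ _ B]) (auto intro: order_trans)
qed

theorem theorem2p2:
  fixes \<phi> :: "real \<Rightarrow> real"
  assumes "\<phi> \<in> {0..} \<rightarrow> {0..}"
    and "strict_mono_on {0..} \<phi>"
    and "filterlim \<phi> at_top at_top"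
  shows
    "(\<forall>(T :: 'a::banach \<Rightarrow> 'a) (a :: nat \<Rightarrow> real) x.
        weakly_almost_periodic scaleR T \<longrightarrow>
        bdd_above ((\<lambda>n. (1 / real n) * (\<Sum>k=1..n. \<bar>a k\<bar> * \<phi> \<bar>a k\<bar>)) ` {1..}) \<longrightarrow>
        flight_vector scaleR T x \<longrightarrow>
        (\<lambda>n. norm ((1 / real n) *\<^sub>R (\<Sum>k=1..n. a k *\<^sub>R (T ^^ k) x))) \<longlonglongrightarrow> 0)
     \<and>
     (\<forall>(smul :: complex \<Rightarrow> 'b::banach \<Rightarrow> 'b) (T :: 'b \<Rightarrow> 'b) (a :: nat \<Rightarrow> complex) x.
        complex_normed_space smul \<longrightarrow>
        weakly_almost_periodic smul T \<longrightarrow>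
        bdd_above ((\<lambda>n. (1 / real n) * (\<Sum>k=1..n. norm (a k) * \<phi> (norm (a k)))) ` {1..}) \<longrightarrow>
        flight_vector smul T x \<longrightarrow>
        (\<lambda>n. norm ((1 / real n) *\<^sub>R (\<Sum>k=1..n. smul (a k) ((T ^^ k) x)))) \<longlonglongrightarrow> 0)"
proof -
  have mono: "mono_on {0..} \<phi>" using assms(2) by (rule strict_mono_on_imp_mono_on)
  note \<phi> = assms(1) mono assms(3)
  have real_case: "(\<lambda>n. norm ((1 / real n) *\<^sub>R (\<Sum>k=1..n. a k *\<^sub>R (T ^^ k) x))) \<longlonglongrightarrow> 0"
    if T: "weakly_almost_periodic scaleR T"
      and bdd: "bdd_above ((\<lambda>n. (1 / real n) * (\<Sum>k=1..n. \<bar>a k\<bar> * \<phi> \<bar>a k\<bar>)) ` {1..})"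
      and x: "flight_vector scaleR T x"
    for T :: "'a \<Rightarrow> 'a" and a :: "nat \<Rightarrow> real" and x
    using T x unfolding weakly_almost_periodic_def flight_vector_def bounded_linear_over_def
    by (intro flight_vector_weighted_average[OF finer_than_weak_real _ _ _ \<phi> bdd]) auto
  have complex_case: "(\<lambda>n. norm ((1 / real n) *\<^sub>R (\<Sum>k=1..n. smul (a k) ((T ^^ k) x)))) \<longlonglongrightarrow> 0"
    if smul: "complex_normed_space smul" and T: "weakly_almost_periodic smul T"
      and bdd: "bdd_above ((\<lambda>n. (1 / real n) * (\<Sum>k=1..n. norm (a k) * \<phi> (norm (a k)))) ` {1..})"
      and x: "flight_vector smul T x"
    for smul :: "complex \<Rightarrow> 'b \<Rightarrow> 'b" and T :: "'b \<Rightarrow> 'b" and a :: "nat \<Rightarrow> complex" and x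
  proof -
    interpret complex_normed_space smul by (rule smul)
    let ?avg = "\<lambda>b n. (1 / real n) *\<^sub>R (\<Sum>k=1..n. b k *\<^sub>R (T ^^ k) x)"
    have part: "(\<lambda>n. norm (?avg b n)) \<longlonglongrightarrow> 0" if b: "\<And>k. \<bar>b k\<bar> \<le> norm (a k)" for b
      using T x unfolding weakly_almost_periodic_def flight_vector_def bounded_linear_over_def
      by (intro flight_vector_weighted_average[OF finer_than_weak_complex[OF smul] _ _ _ \<phi>
            bdd_above_average_mono[OF assms(1) mono b bdd]]) auto
    have "(1 / real n) *\<^sub>R (\<Sum>k=1..n. smul (a k) ((T ^^ k) x))
        = ?avg (\<lambda>k. Re (a k)) n + smul \<i> (?avg (\<lambda>k. Im (a k)) n)" for n
      by (simp add: smul_eq_Re_Im[of "a _"] sum.distrib scaleR_add_right scale_sum_right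
          smul_ii_scaleR)
    then have "norm ((1 / real n) *\<^sub>R (\<Sum>k=1..n. smul (a k) ((T ^^ k) x)))
        \<le> norm (?avg (\<lambda>k. Re (a k)) n) + norm (?avg (\<lambda>k. Im (a k)) n)" for n
      using norm_triangle_ineq[of "?avg (\<lambda>k. Re (a k)) n" "smul \<i> (?avg (\<lambda>k. Im (a k)) n)"]
      by (simp only: norm_smul norm_ii mult_1)
    moreover have "(\<lambda>n. norm (?avg (\<lambda>k. Re (a k)) n) + norm (?avg (\<lambda>k. Im (a k)) n)) \<longlonglongrightarrow> 0 + 0"
      by (intro tendsto_add part abs_Re_le_cmod abs_Im_le_cmod)
    ultimately show ?thesis
      by (intro Lim_null_comparison[of "\<lambda>n. norm ((1 / real n) *\<^sub>R (\<Sum>k=1..n. smul (a k) ((T ^^ k) x)))"])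
        (auto intro!: always_eventually simp del: norm_scaleR)
  qed
  show ?thesis using real_case complex_case by blast
qed

end
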